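(* Let $y\in\mathbb{R}$, $b>0$, $\gamma^{(0)}>0$, and let $(\gamma^{(k)})_{k\ge0}$ be generated by the one-dimensional MacKay (MK) algorithm $$\gamma^{(k+1)}=\frac{y^2\gamma^{(k)}}{b+\gamma^{(k)}},\qquad k\ge0.$$ (i) If $y^2>b$, then $\gamma^{(k)}$ converges to $\gamma^*=y^2-b$ with order of convergence $p=1$ and rate of convergence $\zeta=\frac{b}{y^2}$. (ii) If $y^2<b$, then $\gamma^{(k)}$ converges to $\gamma^*=0$ with order of convergence $p=1$ and rate of convergence $\zeta=\frac{y^2}{b}$. (iii) If $y^2=b$, then $\gamma^{(k)}$ converges to $\gamma^*=0$ in the rate of $O(1/k)$: $$\gamma^{(k)}=\frac{b}{k+b/\gamma^{(0)}},\qquad k\ge0.$$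
   Context: A sequence $\{\gamma^{(k)}\}$ converges to $\gamma^*$ with order of convergence $p$ and rate of convergence $\zeta$ if $\gamma^{(k)}\to\gamma^*$ and $\lim_{k\to\infty}\frac{|\gamma^{(k+1)}-\gamma^*|}{|\gamma^{(k)}-\gamma^*|^p}=\zeta$. The assertion on this limit is understood for sequences with $\gamma^{(k)}\ne\gamma^*$ for all $k$ (so that the quotients are defined); the convergence $\gamma^{(k)}\to\gamma^*$ is asserted in all cases. *)

theory Defs
  imports Complex_Main "HOL-Library.Landau_Symbols"
begin

(* The limit of the quotients is only required when no iterate equals the limit c;
   otherwise some quotient has denominator 0, which HOL would totalise to x / 0 = 0.
   Convergence to c is required unconditionally. *)
definition converges_with_order_and_rate ::
    "(nat \<Rightarrow> real) \<Rightarrow> real \<Rightarrow> real \<Rightarrow> real \<Rightarrow> bool" where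
  "converges_with_order_and_rate X c p \<zeta> \<longleftrightarrow>
     X \<longlonglongrightarrow> c \<and>
     ((\<forall>k. X k \<noteq> c) \<longrightarrow>
        (\<lambda>k. \<bar>X (Suc k) - c\<bar> / \<bar>X k - c\<bar> powr p) \<longlonglongrightarrow> \<zeta>)"

end

theory Submission
  imports Defs
begin

text \<open>
  The update satisfies
  \<open>\<gamma> (Suc k) - (y\<^sup>2 - b) = b / (b + \<gamma> k) * (\<gamma> k - (y\<^sup>2 - b))\<close> and
  \<open>\<gamma> (Suc k) = y\<^sup>2 / (b + \<gamma> k) * \<gamma> k\<close>.
  For \<open>y\<^sup>2 > b\<close> the iterates stay above \<open>min (\<gamma> 0) (y\<^sup>2 - b) > 0\<close>, so the factor in the first
  identity is bounded away from 1; for \<open>y\<^sup>2 < b\<close> the factor in the second one is at most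
  \<open>y\<^sup>2 / b < 1\<close>. Either way the iteration contracts, and the rate is the limit of the factor.
  For \<open>y\<^sup>2 = b\<close> the sequence \<open>1 / \<gamma> k\<close> is arithmetic with difference \<open>1 / b\<close>.
\<close>

text \<open>Iterating the one-step bound gives the geometric bound
  \<open>q ^ k * \<bar>X 0 - c\<bar>\<close> on the error.\<close>

lemma tendsto_of_contraction:
  fixes X :: "nat \<Rightarrow> real"
  assumes "0 \<le> q" "q < 1"
    and step: "\<And>k. \<bar>X (Suc k) - c\<bar> \<le> q * \<bar>X k - c\<bar>"
  shows "X \<longlonglongrightarrow> c"
proof -
  have bound: "\<bar>X k - c\<bar> \<le> q ^ k * \<bar>X 0 - c\<bar>" for k
  proof (induction k)
    case (Suc k)
    have "\<bar>X (Suc k) - c\<bar> \<le> q * \<bar>X k - c\<bar>" by (rule step)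
    also have "\<dots> \<le> q * (q ^ k * \<bar>X 0 - c\<bar>)"
      using Suc \<open>0 \<le> q\<close> by (rule mult_left_mono)
    finally show ?case by (simp add: mult.assoc)
  qed simp
  have "(\<lambda>k. q ^ k * \<bar>X 0 - c\<bar>) \<longlonglongrightarrow> 0"
    using assms by (intro tendsto_mult_left_zero LIMSEQ_power_zero) simp
  then have "(\<lambda>k. X k - c) \<longlonglongrightarrow> 0"
    by (rule tendsto_0_le[where K = 1])
      (auto intro!: always_eventually simp: bound abs_mult \<open>0 \<le> q\<close>)
  then show ?thesis by (simp add: LIM_zero_iff)
qed

text \<open>The uniform bound \<open>q\<close> yields convergence first. Off the limit, the quotient
  of order 1 is exactly \<open>r k\<close>, so the rate is the limit of \<open>r\<close>. The
  premise on \<open>r\<close> may assume convergence of \<open>X\<close> because in the applications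
  \<open>r k\<close> depends on \<open>X k\<close>.\<close>

lemma converges_with_order_1I:
  assumes step: "\<And>k. X (Suc k) - c = r k * (X k - c)"
    and r: "\<And>k. 0 \<le> r k" "\<And>k. r k \<le> q" "q < 1"
    and lim: "X \<longlonglongrightarrow> c \<Longrightarrow> r \<longlonglongrightarrow> \<zeta>"
  shows "converges_with_order_and_rate X c 1 \<zeta>"
proof -
  have "0 \<le> q" using r(1)[of 0] r(2)[of 0] by linarith
  have abs_step: "\<bar>X (Suc k) - c\<bar> = r k * \<bar>X k - c\<bar>" for k
    by (simp add: step abs_mult r(1))
  have "X \<longlonglongrightarrow> c"
    using \<open>0 \<le> q\<close> r(3) by (rule tendsto_of_contraction) (simp add: abs_step r(2) mult_right_mono)
  moreover have "(\<lambda>k. \<bar>X (Suc k) - c\<bar> / \<bar>X k - c\<bar> powr 1) = r" if "\<forall>k. X k \<noteq> c"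
    using that by (simp add: abs_step)
  ultimately show ?thesis
    unfolding converges_with_order_and_rate_def using lim by simp
qed

theorem proposition4p2:
  fixes y b :: real and \<gamma> :: "nat \<Rightarrow> real"
  assumes "b > 0"
    and "\<gamma> 0 > 0"
    and "\<And>k. \<gamma> (Suc k) = y\<^sup>2 * \<gamma> k / (b + \<gamma> k)"
  shows "(y\<^sup>2 > b \<longrightarrow> converges_with_order_and_rate \<gamma> (y\<^sup>2 - b) 1 (b / y\<^sup>2)) \<and>
         (y\<^sup>2 < b \<longrightarrow> converges_with_order_and_rate \<gamma> 0 1 (y\<^sup>2 / b)) \<and>
         (y\<^sup>2 = b \<longrightarrow>
            \<gamma> \<longlonglongrightarrow> 0 \<and>
            \<gamma> \<in> O(\<lambda>k. 1 / real k) \<and>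
            (\<forall>k. \<gamma> k = b / (real k + b / \<gamma> 0)))"
proof (intro conjI impI)
  note b = assms(1) and step = assms(3)
  \<comment> \<open>Strict positivity can fail: for \<open>y = 0\<close> every iterate after the
    first is 0.\<close>
  have nonneg: "0 \<le> \<gamma> k" for k
    by (induction k) (use assms in auto)
  have pos: "0 < b + \<gamma> k" for k
    using b nonneg[of k] by linarith
  {
    assume "y\<^sup>2 > b"
    define m where "m = min (\<gamma> 0) (y\<^sup>2 - b)"
    have m: "0 < m" "m \<le> y\<^sup>2 - b"
      using assms(2) \<open>y\<^sup>2 > b\<close> by (auto simp: m_def)
    have ge: "m \<le> \<gamma> k" for k
    proof (induction k)
      case (Suc k)
      \<comment> \<open>This says that the update does not decrease \<open>m\<close>, since
        \<open>m \<le> y\<^sup>2 - b\<close>. Adding the next inequality, whose factor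
        \<open>y\<^sup>2 - m\<close> is at least \<open>b\<close>, passes from \<open>m\<close> to
        \<open>\<gamma> k\<close>.\<close>
      have "m * (b + m) \<le> m * y\<^sup>2"
        using m by (intro mult_left_mono) auto
      moreover have "m * (y\<^sup>2 - m) \<le> \<gamma> k * (y\<^sup>2 - m)"
        using Suc m b by (intro mult_right_mono) auto
      ultimately have "m * (b + \<gamma> k) \<le> y\<^sup>2 * \<gamma> k"
        by (simp add: algebra_simps)
      then show ?case
        using pos[of k] by (simp add: step pos_le_divide_eq)
    qed (simp add: m_def)
    show "converges_with_order_and_rate \<gamma> (y\<^sup>2 - b) 1 (b / y\<^sup>2)"
    proof (rule converges_with_order_1I)
      show "\<gamma> (Suc k) - (y\<^sup>2 - b) = b / (b + \<gamma> k) * (\<gamma> k - (y\<^sup>2 - b))" for k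
        using pos[of k] by (simp add: step field_simps)
      show "0 \<le> b / (b + \<gamma> k)" for k
        using b pos[of k] by simp
      show "b / (b + \<gamma> k) \<le> b / (b + m)" for k
        using b m ge[of k] by (intro divide_left_mono) auto
      show "b / (b + m) < 1"
        using b m by simp
      assume "\<gamma> \<longlonglongrightarrow> y\<^sup>2 - b"
      then have "(\<lambda>k. b / (b + \<gamma> k)) \<longlonglongrightarrow> b / (b + (y\<^sup>2 - b))"
        using b \<open>y\<^sup>2 > b\<close> by (intro tendsto_intros) auto
      then show "(\<lambda>k. b / (b + \<gamma> k)) \<longlonglongrightarrow> b / y\<^sup>2" by simp
    qed
  next
    assume "y\<^sup>2 < b"
    show "converges_with_order_and_rate \<gamma> 0 1 (y\<^sup>2 / b)"
    proof (rule converges_with_order_1I)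
      show "\<gamma> (Suc k) - 0 = y\<^sup>2 / (b + \<gamma> k) * (\<gamma> k - 0)" for k
        by (simp add: step)
      show "0 \<le> y\<^sup>2 / (b + \<gamma> k)" for k
        using pos[of k] by simp
      show "y\<^sup>2 / (b + \<gamma> k) \<le> y\<^sup>2 / b" for k
        using b nonneg[of k] by (intro divide_left_mono) auto
      show "y\<^sup>2 / b < 1"
        using b \<open>y\<^sup>2 < b\<close> by simp
      assume "\<gamma> \<longlonglongrightarrow> 0"
      then have "(\<lambda>k. y\<^sup>2 / (b + \<gamma> k)) \<longlonglongrightarrow> y\<^sup>2 / (b + 0)"
        using b by (intro tendsto_intros) auto
      then show "(\<lambda>k. y\<^sup>2 / (b + \<gamma> k)) \<longlonglongrightarrow> y\<^sup>2 / b" by simp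
    qed
  next
    assume "y\<^sup>2 = b"
    define a where "a = b / \<gamma> 0"
    have "0 < a" using assms by (simp add: a_def)
    have closed: "\<gamma> k = b / (real k + a)" for k
    proof (induction k)
      case 0
      show ?case using assms by (simp add: a_def)
    next
      case (Suc k)
      have "0 < real k + a" using \<open>0 < a\<close> by simp
      \<comment> \<open>This is the denominator \<open>b + \<gamma> k\<close> of the update, written
        so that \<open>real k + a\<close> cancels.\<close>
      then have "b + b / (real k + a) = b * (real (Suc k) + a) / (real k + a)"
        by (simp add: field_simps)
      then show ?case
        using \<open>0 < real k + a\<close> b by (simp add: step Suc \<open>y\<^sup>2 = b\<close>)
    qed
    \<comment> \<open>Dropping \<open>a\<close> from the denominator gives the constant
      \<open>b\<close>. The bound fails at \<open>k = 0\<close>, where \<open>1 / real k\<close> is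
      0 but \<open>\<gamma> 0\<close> is positive.\<close>
    have le: "\<bar>\<gamma> k\<bar> \<le> b * \<bar>1 / real k\<bar>" if "0 < k" for k
      using that b \<open>0 < a\<close> nonneg[of k] by (simp add: closed[of k] frac_le)
    show "\<gamma> \<in> O(\<lambda>k. 1 / real k)"
      by (rule bigoI[of _ b], rule eventually_sequentiallyI[of 1]) (simp only: real_norm_def le)
    show "\<gamma> \<longlonglongrightarrow> 0"
    proof (rule tendsto_0_le[OF lim_1_over_n])
      show "\<forall>\<^sub>F k in sequentially. norm (\<gamma> k) \<le> norm (1 / real k) * b"
        using le by (intro eventually_sequentiallyI[of 1]) (auto simp: mult.commute)
    qed
    show "\<forall>k. \<gamma> k = b / (real k + b / \<gamma> 0)"
      using closed unfolding a_def by blast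
  }
qed

end
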